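(* For a finite simple graph $G$, the following assertions are equivalent: (i) $G$ is a König–Egerváry graph; (ii) every non-empty family of maximum critical independent sets of $G$ is a König–Egerváry collection; (iii) there is a (non-empty) König–Egerváry collection of maximum critical independent sets of $G$.
   Context: For a graph $G$ and $A\subseteq V(G)$: $N(A)=\{v\in V(G): v \text{ has a neighbor in } A\}$. A set is independent if no two of its vertices are adjacent; $\mathrm{Ind}(G)$ is the family of independent sets and $\alpha(G)$ the maximum size of an independent set. $\mu(G)$ is the maximum cardinality of a matching. $G$ is a König–Egerváry graph if $\alpha(G)+\mu(G)=|V(G)|$. The difference of $X\subseteq V(G)$ is $d(X)=|X|-|N(X)|$. An independent set $A$ is critical if $d(A)=\max\{d(I):I\in\mathrm{Ind}(G)\}$. A maximum critical independent set is a critical independent set of maximum cardinality among all critical independent sets. A non-empty family $\Gamma$ of independent sets of $G$ is a König–Egerváry collection if $\left|\bigcap\Gamma\right|+\left|\bigcup\Gamma\right|=2\alpha(G)$. *)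

theory Defs
  imports "Graph_Theory.Digraph"
begin

text \<open>
  A finite simple graph is a \<^term>\<open>G\<close> with \<^term>\<open>graph G\<close>: finite, loop-free, without multiple
  arcs and symmetric. Each undirected edge \<open>uv\<close> is thus a pair of opposite arcs; for cardinalities
  of edge sets we therefore pass to the two-element sets \<open>{u, v}\<close>.
\<close>

definition uedges :: "('a, 'b) pre_digraph \<Rightarrow> 'a set set" where
  "uedges G = {{u, v} | u v. u \<rightarrow>\<^bsub>G\<^esub> v}"

definition neighborhood :: "('a, 'b) pre_digraph \<Rightarrow> 'a set \<Rightarrow> 'a set" where
  "neighborhood G A = {v \<in> verts G. \<exists>u\<in>A. v \<rightarrow>\<^bsub>G\<^esub> u}"

definition independent_sets :: "('a, 'b) pre_digraph \<Rightarrow> 'a set set" where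
  "independent_sets G = {A. A \<subseteq> verts G \<and> (\<forall>u\<in>A. \<forall>v\<in>A. \<not> u \<rightarrow>\<^bsub>G\<^esub> v)}"

definition independence_number :: "('a, 'b) pre_digraph \<Rightarrow> nat" where
  "independence_number G = Max (card ` independent_sets G)"

definition matchings :: "('a, 'b) pre_digraph \<Rightarrow> 'a set set set" where
  "matchings G = {M. M \<subseteq> uedges G \<and> pairwise disjnt M}"

definition matching_number :: "('a, 'b) pre_digraph \<Rightarrow> nat" where
  "matching_number G = Max (card ` matchings G)"

definition koenig_egervary_graph :: "('a, 'b) pre_digraph \<Rightarrow> bool" where
  "koenig_egervary_graph G \<longleftrightarrow>
     independence_number G + matching_number G = card (verts G)"

definition difference :: "('a, 'b) pre_digraph \<Rightarrow> 'a set \<Rightarrow> int" where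
  "difference G X = int (card X) - int (card (neighborhood G X))"

definition critical_independent_sets :: "('a, 'b) pre_digraph \<Rightarrow> 'a set set" where
  "critical_independent_sets G =
     {A \<in> independent_sets G. difference G A = Max (difference G ` independent_sets G)}"

definition maximum_critical_independent_sets :: "('a, 'b) pre_digraph \<Rightarrow> 'a set set" where
  "maximum_critical_independent_sets G =
     {A \<in> critical_independent_sets G. card A = Max (card ` critical_independent_sets G)}"

definition koenig_egervary_collection :: "('a, 'b) pre_digraph \<Rightarrow> 'a set set \<Rightarrow> bool" where
  "koenig_egervary_collection G \<Gamma> \<longleftrightarrow>
     \<Gamma> \<noteq> {} \<and> \<Gamma> \<subseteq> independent_sets G \<and>
     card (\<Inter>\<Gamma>) + card (\<Union>\<Gamma>) = 2 * independence_number G"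

end

(*
  Write d(X) = |X| - |N(X)|. Since d is supermodular and its maximum over all vertex sets is attained
  at independent ones, unions of critical sets are critical. An exchange argument shows that
  A \<union> N(A) is the same set X for every maximum critical independent set A, so the union U and the
  intersection K of a family of such sets satisfy N(U) = X - K. Then d(U) = d(A) reads
  |U| + |K| = 2 |A|, and the family is a Koenig-Egervary collection iff |A| = \<alpha>(G). This in turn
  characterises Koenig-Egervary graphs: a matching of size \<mu> forces d \<le> |V| - 2 \<mu>, which makes
  maximum independent sets critical when \<alpha> + \<mu> = |V|; conversely, Hall's theorem matches N(A)
  into A, and N(A) = V - A when |A| = \<alpha>.
*)
theory Submission
  imports Defs
begin

section \<open>Hall's marriage theorem\<close>

text \<open>Induction on the index set. A tight proper subfamily is matched first and its elements
  are withheld from the rest. If there is none, every proper subfamily has an element to spare, so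
  one index may take any element of its set.\<close>

theorem hall_marriage:
  fixes S :: "'i \<Rightarrow> 'b set"
  assumes "finite I" and "\<And>i. i \<in> I \<Longrightarrow> finite (S i)"
    and "\<And>J. J \<subseteq> I \<Longrightarrow> card J \<le> card (\<Union>(S ` J))"
  shows "\<exists>f. inj_on f I \<and> (\<forall>i\<in>I. f i \<in> S i)"
  using assms
proof (induction I arbitrary: S rule: finite_psubset_induct)
  case (psubset I)
  note hall = psubset.prems(2)
  show ?case
  proof (cases "\<exists>J. J \<subset> I \<and> J \<noteq> {} \<and> card (\<Union>(S ` J)) = card J")
    case True
    then obtain J where J: "J \<subset> I" "J \<noteq> {}" "card (\<Union>(S ` J)) = card J" by blast
    obtain f where f: "inj_on f J" "\<forall>i\<in>J. f i \<in> S i"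
      using psubset.IH[of J S] J psubset.prems by (meson order_trans psubset_imp_subset subsetD)
    define S' where "S' i = S i - \<Union>(S ` J)" for i
    have "card H \<le> card (\<Union>(S' ` H))" if H: "H \<subseteq> I - J" for H
    proof -
      \<comment> \<open>Hall's condition for \<open>S'\<close> on H follows from the one for
        \<open>S\<close> on H \<union> J: the contribution of J cancels because J is tight.\<close>
      have "H \<union> J \<subseteq> I" using H J by blast
      have "finite H" "finite J" "H \<inter> J = {}"
        using psubset.hyps H J by (auto dest: finite_subset)
      then have "card H + card J = card (H \<union> J)" by (simp add: card_Un_disjoint)
      also have "\<dots> \<le> card (\<Union>(S ` (H \<union> J)))" by (rule hall) fact
      also have "\<Union>(S ` (H \<union> J)) = \<Union>(S' ` H) \<union> \<Union>(S ` J)" by (auto simp: S'_def)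
      also have "card \<dots> \<le> card (\<Union>(S' ` H)) + card (\<Union>(S ` J))" by (rule card_Un_le)
      finally show ?thesis using J(3) by simp
    qed
    moreover have "I - J \<subset> I" using J by blast
    ultimately obtain g where g: "inj_on g (I - J)" "\<forall>i\<in>I - J. g i \<in> S' i"
      using psubset.IH[of "I - J" S'] psubset.prems(1) by (auto simp: S'_def)
    let ?h = "\<lambda>i. if i \<in> J then f i else g i"
    have sep: "g j \<noteq> f i" if "i \<in> J" "j \<in> I - J" for i j
    proof -
      have "f i \<in> \<Union>(S ` J)" using f(2) that by blast
      moreover have "g j \<notin> \<Union>(S ` J)" using g(2) that(2) unfolding S'_def by blast
      ultimately show ?thesis by metis
    qed
    have "inj_on ?h I"
    proof (rule inj_onI)
      fix i j assume "i \<in> I" "j \<in> I" "?h i = ?h j"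
      then show "i = j"
        using inj_onD[OF f(1), of i j] inj_onD[OF g(1), of i j] sep[of i j] sep[of j i]
        by (cases "i \<in> J"; cases "j \<in> J") auto
    qed
    moreover have "\<forall>i\<in>I. ?h i \<in> S i" using f(2) g(2) by (auto simp: S'_def)
    ultimately show ?thesis by blast
  next
    case False
    then have strict: "card J < card (\<Union>(S ` J))" if "J \<subset> I" "J \<noteq> {}" for J
      using that hall[of J] by (metis le_neq_implies_less psubset_imp_subset)
    show ?thesis
    proof (cases "I = {}")
      case False
      then obtain i where i: "i \<in> I" by blast
      have "S i \<noteq> {}" using hall[of "{i}"] i by auto
      then obtain x where x: "x \<in> S i" by blast
      define S' where "S' j = S j - {x}" for j
      have "card H \<le> card (\<Union>(S' ` H))" if H: "H \<subseteq> I - {i}" for H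
      proof (cases "H = {}")
        case False
        have "H \<subset> I" using H i by blast
        \<comment> \<open>The strict surplus pays for the loss of x.\<close>
        then have "card H < card (\<Union>(S ` H))" using strict False by blast
        moreover have "\<Union>(S' ` H) = \<Union>(S ` H) - {x}" by (auto simp: S'_def)
        ultimately show ?thesis by (auto simp: card_Diff_singleton_if)
      qed simp
      moreover have "I - {i} \<subset> I" using i by blast
      ultimately obtain g where g: "inj_on g (I - {i})" "\<forall>j\<in>I - {i}. g j \<in> S' j"
        using psubset.IH[of "I - {i}" S'] psubset.prems(1) by (auto simp: S'_def)
      have "inj_on (g(i := x)) I" using g by (auto simp: inj_on_def S'_def)
      moreover have "\<forall>j\<in>I. (g(i := x)) j \<in> S j" using g(2) x by (auto simp: S'_def)
      ultimately show ?thesis by blast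
    qed simp
  qed
qed

section \<open>Neighborhoods, independent sets and supermodularity of d\<close>

context graph
begin

lemma finite_subset_verts: "X \<subseteq> verts G \<Longrightarrow> finite X"
  by (rule finite_subset[OF _ finite_verts])

lemma adj_sym: "u \<rightarrow> v \<Longrightarrow> v \<rightarrow> u"
  by (rule arcs_ends_symmetric[OF sym_arcs])

lemma neighborhood_subset: "neighborhood G A \<subseteq> verts G"
  by (auto simp: neighborhood_def)

lemma finite_neighborhood [simp]: "finite (neighborhood G A)"
  by (rule finite_subset_verts[OF neighborhood_subset])

lemma neighborhood_mono: "A \<subseteq> B \<Longrightarrow> neighborhood G A \<subseteq> neighborhood G B"
  by (auto simp: neighborhood_def)

lemma neighborhood_Un: "neighborhood G (A \<union> B) = neighborhood G A \<union> neighborhood G B"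
  by (auto simp: neighborhood_def)

lemma independent_sets_iff:
  "A \<in> independent_sets G \<longleftrightarrow> A \<subseteq> verts G \<and> A \<inter> neighborhood G A = {}"
  by (auto simp: independent_sets_def neighborhood_def)

text \<open>Both sides express that no edge joins A and B.\<close>

lemma disjoint_neighborhood_sym:
  assumes "A \<inter> neighborhood G B = {}"
  shows "B \<inter> neighborhood G A = {}"
proof -
  have "\<not> v \<rightarrow> u" if "v \<in> B" "u \<in> A" for u v
  proof
    assume "v \<rightarrow> u"
    then have "u \<rightarrow> v" "u \<in> verts G" using adj_sym adj_in_verts(2) by simp_all
    then show False using assms(1) that by (auto simp: neighborhood_def)
  qed
  then show ?thesis by (auto simp: neighborhood_def)
qed

lemma finite_independent_sets [simp]: "finite (independent_sets G)"
  by (rule finite_subset[of _ "Pow (verts G)"]) (auto simp: independent_sets_def)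

lemma empty_independent [simp]: "{} \<in> independent_sets G"
  by (simp add: independent_sets_def)

lemma independent_subset_verts: "A \<in> independent_sets G \<Longrightarrow> A \<subseteq> verts G"
  by (simp add: independent_sets_def)

lemma finite_independent: "A \<in> independent_sets G \<Longrightarrow> finite A"
  by (intro finite_subset_verts independent_subset_verts)

text \<open>Cardinality is modular, and N preserves unions but sends X \<inter> Y only into N(X)
  \<inter> N(Y).\<close>

lemma difference_supermodular:
  assumes "X \<subseteq> verts G" "Y \<subseteq> verts G"
  shows "difference G X + difference G Y \<le> difference G (X \<union> Y) + difference G (X \<inter> Y)"
proof -
  have "finite X" "finite Y" using assms finite_subset_verts by auto
  then have "card X + card Y = card (X \<union> Y) + card (X \<inter> Y)" by (rule card_Un_Int)
  moreover have "card (neighborhood G X) + card (neighborhood G Y) =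
      card (neighborhood G (X \<union> Y)) + card (neighborhood G X \<inter> neighborhood G Y)"
    unfolding neighborhood_Un by (intro card_Un_Int) simp_all
  moreover have "card (neighborhood G (X \<inter> Y)) \<le> card (neighborhood G X \<inter> neighborhood G Y)"
    by (intro card_mono) (auto simp: neighborhood_def)
  ultimately show ?thesis by (simp add: difference_def)
qed

section \<open>Sets attaining the maximum difference\<close>

abbreviation max_difference :: int where
  "max_difference \<equiv> Max (difference G ` independent_sets G)"

text \<open>Deleting from \<open>X\<close> its vertices with a neighbor in \<open>X\<close> makes it independent
  and removes at least as many vertices from its neighborhood.\<close>

lemma difference_le_max_difference:
  assumes "X \<subseteq> verts G"
  shows "difference G X \<le> max_difference"
proof -
  let ?N = "neighborhood G X" and ?I = "X - neighborhood G X"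
  have fin: "finite X" using assms finite_subset_verts by auto
  \<comment> \<open>As \<open>?I\<close> avoids N(X), no edge joins it to X, so N(\<open>?I\<close>)
    misses X.\<close>
  have sub: "neighborhood G ?I \<subseteq> ?N - X \<inter> ?N"
    using disjoint_neighborhood_sym[of ?I X] neighborhood_mono[of ?I X] by blast
  then have "?I \<in> independent_sets G"
    using assms by (auto simp: independent_sets_iff)
  then have "difference G ?I \<le> max_difference" by simp
  moreover have "card (neighborhood G ?I) \<le> card ?N - card (X \<inter> ?N)"
    using card_mono[OF _ sub] fin by (simp add: card_Diff_subset)
  moreover have "card (X \<inter> ?N) \<le> card ?N" by (simp add: card_mono)
  moreover have "card X = card ?I + card (X \<inter> ?N)"
    using fin by (metis card_Int_Diff add.commute)
  ultimately show ?thesis by (simp add: difference_def)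
qed

text \<open>Supermodularity leaves no slack, since neither the union nor the intersection exceeds
  the maximum. A union of independent sets may fail to be independent, hence the bound for arbitrary
  vertex sets.\<close>

lemma difference_Un_eq_max:
  assumes "X \<subseteq> verts G" "Y \<subseteq> verts G"
    and "difference G X = max_difference" "difference G Y = max_difference"
  shows "difference G (X \<union> Y) = max_difference"
  using difference_supermodular[OF assms(1,2)] difference_le_max_difference[of "X \<union> Y"]
    difference_le_max_difference[of "X \<inter> Y"] assms by (simp add: le_infI1)

lemma difference_Union_eq_max:
  assumes "finite \<Gamma>" "\<Gamma> \<noteq> {}"
    and "\<And>A. A \<in> \<Gamma> \<Longrightarrow> A \<subseteq> verts G \<and> difference G A = max_difference"
  shows "difference G (\<Union>\<Gamma>) = max_difference"
  using assms
proof (induction \<Gamma> rule: finite_ne_induct)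
  case (insert A \<Gamma>)
  then show ?case using difference_Un_eq_max[of A "\<Union>\<Gamma>"] by (simp add: Sup_le_iff)
qed simp

lemma critical_independent_setsD:
  assumes "A \<in> critical_independent_sets G"
  shows "A \<in> independent_sets G" "A \<subseteq> verts G" "finite A" "A \<inter> neighborhood G A = {}"
    "difference G A = max_difference"
  using assms finite_independent
  by (auto simp: critical_independent_sets_def independent_sets_iff)

lemma finite_critical_independent_sets [simp]: "finite (critical_independent_sets G)"
  by (simp add: critical_independent_sets_def)

lemma maximum_critical_independent_setsD:
  assumes "A \<in> maximum_critical_independent_sets G"
  shows "A \<in> critical_independent_sets G"
    "B \<in> critical_independent_sets G \<Longrightarrow> card B \<le> card A"
  using assms by (auto simp: maximum_critical_independent_sets_def)

lemma maximum_critical_independent_sets_nonempty: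
  "maximum_critical_independent_sets G \<noteq> {}"
proof -
  have "max_difference \<in> difference G ` independent_sets G"
    by (intro Max_in) (auto intro: empty_independent)
  then have "critical_independent_sets G \<noteq> {}"
    by (auto simp: critical_independent_sets_def)
  then have "Max (card ` critical_independent_sets G) \<in> card ` critical_independent_sets G"
    by (intro Max_in) auto
  then show ?thesis by (auto simp: maximum_critical_independent_sets_def)
qed

lemma finite_maximum_critical_independent_sets:
  "finite (maximum_critical_independent_sets G)"
  by (simp add: maximum_critical_independent_sets_def)

section \<open>The exchange argument for maximum critical independent sets\<close>

text \<open>Passing from A \<union> B to \<open>?I\<close> costs the vertices of B \<inter> N(A),
  while the neighborhood loses at least A \<inter> N(B), because no edge joins \<open>?I\<close> to
  A. The two correction terms trade places when A and B do.\<close>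

lemma difference_Un_Diff_neighborhood:
  assumes "A \<in> independent_sets G" "B \<in> independent_sets G"
  shows "A \<union> B - neighborhood G A \<in> independent_sets G" (is "?I \<in> _")
    and "difference G (A \<union> B) + int (card (A \<inter> neighborhood G B)) \<le>
      difference G (A \<union> B - neighborhood G A) + int (card (B \<inter> neighborhood G A))"
proof -
  let ?N = "neighborhood G (A \<union> B)"
  have A: "A \<subseteq> verts G" "A \<inter> neighborhood G A = {}" "finite A"
    and B: "B \<subseteq> verts G" "B \<inter> neighborhood G B = {}" "finite B"
    using assms finite_independent by (auto simp: independent_sets_iff)
  have NI: "neighborhood G ?I \<inter> A = {}"
    using disjoint_neighborhood_sym[of ?I A] by blast
  have I: "?I \<subseteq> A \<union> B" by blast
  have "?I \<inter> neighborhood G ?I = {}"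
  proof -
    have "(B - neighborhood G A) \<inter> neighborhood G A = {}" by blast
    moreover have "neighborhood G ?I \<subseteq> neighborhood G A \<union> neighborhood G B"
      using neighborhood_mono[OF I] by (simp add: neighborhood_Un)
    ultimately show ?thesis using NI B(2) by blast
  qed
  then show ind: "?I \<in> independent_sets G"
    using A B by (auto simp: independent_sets_iff)
  have "neighborhood G ?I \<subseteq> ?N - A \<inter> neighborhood G B"
    using NI neighborhood_mono[OF I] by blast
  then have "card (neighborhood G ?I) \<le> card (?N - A \<inter> neighborhood G B)"
    by (simp add: card_mono)
  moreover have "card ?N = card (A \<inter> neighborhood G B) + card (?N - A \<inter> neighborhood G B)"
  proof -
    have "?N \<inter> (A \<inter> neighborhood G B) = A \<inter> neighborhood G B"
      by (auto simp: neighborhood_Un)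
    then show ?thesis using card_Int_Diff[of ?N "A \<inter> neighborhood G B"] by simp
  qed
  moreover have "card (A \<union> B) = card (B \<inter> neighborhood G A) + card ?I"
    using card_Int_Diff[of "A \<union> B" "neighborhood G A"] A B by (simp add: Int_Un_distrib2)
  ultimately show "difference G (A \<union> B) + int (card (A \<inter> neighborhood G B)) \<le>
      difference G ?I + int (card (B \<inter> neighborhood G A))"
    by (simp add: difference_def)
qed

text \<open>A vertex of B outside A \<union> N(A) would survive in \<open>?I\<close>, which turns
  out to be a critical independent set containing A; maximality of A excludes this.\<close>

lemma maximum_critical_Diff_subset_neighborhood:
  assumes A: "A \<in> maximum_critical_independent_sets G"
    and B: "B \<in> maximum_critical_independent_sets G"
  shows "B - A \<subseteq> neighborhood G A"
proof -
  note cA = critical_independent_setsD[OF maximum_critical_independent_setsD(1)[OF A]]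
  note cB = critical_independent_setsD[OF maximum_critical_independent_setsD(1)[OF B]]
  let ?I = "A \<union> B - neighborhood G A" and ?J = "A \<union> B - neighborhood G B"
  have U: "difference G (A \<union> B) = max_difference"
    by (rule difference_Un_eq_max) (use cA cB in auto)
  note I = difference_Un_Diff_neighborhood[OF cA(1) cB(1)]
  note J = difference_Un_Diff_neighborhood[OF cB(1) cA(1), unfolded Un_commute[of B A]]
  have "difference G ?I \<le> max_difference" "difference G ?J \<le> max_difference"
    using I(1) J(1) by simp_all
  \<comment> \<open>In the sum of the two exchange inequalities the correction terms cancel, so
    d(\<open>?I\<close>) + d(\<open>?J\<close>) is at least twice the maximum.\<close>
  then have "difference G ?I = max_difference" using I(2) J(2) U by linarith
  then have "?I \<in> critical_independent_sets G"
    using I(1) by (simp add: critical_independent_sets_def)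
  then have "card ?I \<le> card A" by (rule maximum_critical_independent_setsD(2)[OF A])
  moreover have "A \<subseteq> ?I" using cA(4) by blast
  moreover have "finite ?I" using cA cB by simp
  ultimately have "A = ?I" by (metis card_seteq)
  then show ?thesis by blast
qed

text \<open>Counting with d(A \<union> B) = d(A) gives N(A \<union> B) = N(A) \<union> (A - B),
  which confines N(B); B itself is confined by the preceding lemma. One inclusion suffices, as A and
  B may be swapped.\<close>

lemma maximum_critical_closed_neighborhood_subset:
  assumes A: "A \<in> maximum_critical_independent_sets G"
    and B: "B \<in> maximum_critical_independent_sets G"
  shows "B \<union> neighborhood G B \<subseteq> A \<union> neighborhood G A"
proof -
  note cA = critical_independent_setsD[OF maximum_critical_independent_setsD(1)[OF A]]
  note cB = critical_independent_setsD[OF maximum_critical_independent_setsD(1)[OF B]]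
  let ?U = "A \<union> B"
  have eq: "card A = card B"
    using A B by (simp add: maximum_critical_independent_sets_def)
  have "difference G ?U = max_difference"
    by (rule difference_Un_eq_max) (use cA cB in auto)
  then have "int (card ?U) - int (card (neighborhood G ?U)) =
      int (card A) - int (card (neighborhood G A))"
    using cA(5) by (simp add: difference_def)
  \<comment> \<open>The union is split as B and A - B, and |B| = |A|.\<close>
  moreover have "card ?U = card A + card (A - B)"
    using card_Un_disjoint[of B "A - B"] cA(3) cB(3) eq by (simp add: Un_commute)
  moreover have "card (neighborhood G A \<union> (A - B)) = card (neighborhood G A) + card (A - B)"
    using cA by (intro card_Un_disjoint) auto
  ultimately have "card (neighborhood G ?U) = card (neighborhood G A \<union> (A - B))"
    by linarith
  moreover have "neighborhood G A \<union> (A - B) \<subseteq> neighborhood G ?U"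
    using maximum_critical_Diff_subset_neighborhood[OF B A] by (auto simp: neighborhood_Un)
  ultimately have "neighborhood G A \<union> (A - B) = neighborhood G ?U"
    by (simp add: card_subset_eq)
  then show ?thesis
    using maximum_critical_Diff_subset_neighborhood[OF A B] by (auto simp: neighborhood_Un)
qed

text \<open>All members \<open>A\<close> of the family share the same \<open>X = A \<union> N(A)\<close>, so
  \<open>N(\<Union>\<Gamma>) = X - \<Inter>\<Gamma>\<close>; the claim is then \<open>d(\<Union>\<Gamma>) = d(A)\<close>.\<close>

lemma maximum_critical_card_Inter_Union:
  assumes sub: "\<Gamma> \<subseteq> maximum_critical_independent_sets G" and A: "A \<in> \<Gamma>"
  shows "card (\<Inter>\<Gamma>) + card (\<Union>\<Gamma>) = 2 * card A"
proof -
  define X where "X = A \<union> neighborhood G A"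
  have crit: "B \<in> critical_independent_sets G" if "B \<in> \<Gamma>" for B
    using that sub by (intro maximum_critical_independent_setsD(1)) auto
  note cA = critical_independent_setsD[OF crit[OF A]]
  have X: "B \<union> neighborhood G B = X" if "B \<in> \<Gamma>" for B
    unfolding X_def using that sub A
    by (intro equalityI maximum_critical_closed_neighborhood_subset) auto
  \<comment> \<open>Independence makes B and N(B) complementary in X, so the union of the
    neighborhoods is the complement of the intersection.\<close>
  have N: "neighborhood G B = X - B" if "B \<in> \<Gamma>" for B
    using X[OF that] critical_independent_setsD(4)[OF crit[OF that]] by blast
  have finX: "finite X" using cA by (simp add: X_def)
  have "finite \<Gamma>" by (rule finite_subset[OF sub finite_maximum_critical_independent_sets])
  then have "difference G (\<Union>\<Gamma>) = difference G A"
    unfolding cA(5) using A critical_independent_setsD(2,5)[OF crit]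
    by (intro difference_Union_eq_max) auto
  moreover have "neighborhood G (\<Union>\<Gamma>) = (\<Union>B\<in>\<Gamma>. neighborhood G B)"
    by (auto simp: neighborhood_def)
  then have "neighborhood G (\<Union>\<Gamma>) = X - \<Inter>\<Gamma>" using N by auto
  moreover have "neighborhood G A = X - A" by (rule N[OF A])
  moreover have "A \<subseteq> X" "\<Inter>\<Gamma> \<subseteq> X" using A by (auto simp: X_def)
  moreover from this have "card (X - A) = card X - card A" "card (X - \<Inter>\<Gamma>) = card X - card (\<Inter>\<Gamma>)"
    "card A \<le> card X" "card (\<Inter>\<Gamma>) \<le> card X"
    using finX by (simp_all add: card_Diff_subset card_mono finite_subset[OF _ finX])
  ultimately show ?thesis by (simp add: difference_def)
qed

section \<open>Bounds from independent sets and matchings\<close>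

lemma independence_number_eq:
  obtains S where "S \<in> independent_sets G" "card S = independence_number G"
proof -
  have "independence_number G \<in> card ` independent_sets G"
    unfolding independence_number_def by (intro Max_in) (auto intro: empty_independent)
  then show thesis using that by auto
qed

lemma card_le_independence_number:
  "A \<in> independent_sets G \<Longrightarrow> card A \<le> independence_number G"
  by (simp add: independence_number_def)

lemma finite_matchings [simp]: "finite (matchings G)"
proof -
  have "uedges G \<subseteq> Pow (verts G)" by (auto simp: uedges_def adj_in_verts)
  then have "matchings G \<subseteq> Pow (Pow (verts G))" by (auto simp: matchings_def)
  then show ?thesis by (rule finite_subset) simp
qed

lemma matching_number_eq:
  obtains M where "M \<in> matchings G" "card M = matching_number G"
proof -
  have "{} \<in> matchings G" by (simp add: matchings_def)
  then have "matching_number G \<in> card ` matchings G"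
    unfolding matching_number_def by (intro Max_in) auto
  then show thesis using that by auto
qed

text \<open>Disjointness of the edges allows counting edge by edge; Y will be X, N(X) and the whole
  vertex set.\<close>

lemma matching_card_Int:
  assumes "M \<in> matchings G" "finite Y"
  shows "card (\<Union>M \<inter> Y) = (\<Sum>e\<in>M. card (e \<inter> Y))"
proof -
  have M: "M \<subseteq> uedges G" "pairwise disjnt M" using assms by (auto simp: matchings_def)
  have "M \<subseteq> Pow (verts G)" using M by (auto simp: uedges_def adj_in_verts)
  then have "finite M" by (rule finite_subset) simp
  moreover have "\<forall>e\<in>M. \<forall>f\<in>M. e \<noteq> f \<longrightarrow> (e \<inter> Y) \<inter> (f \<inter> Y) = {}"
    using M(2) by (auto simp: pairwise_def disjnt_def)
  ultimately have "card (\<Union>e\<in>M. e \<inter> Y) = (\<Sum>e\<in>M. card (e \<inter> Y))"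
    using assms(2) by (intro card_UN_disjoint) auto
  moreover have "(\<Union>e\<in>M. e \<inter> Y) = \<Union>M \<inter> Y" by blast
  ultimately show ?thesis by simp
qed

text \<open>If one end of a matching edge lies in X, the other lies in N(X). So the matched part of
  X has at most |N(X)| vertices, and the rest lies among the |V| - 2 |M| unmatched vertices.\<close>

lemma difference_le_unmatched:
  assumes M: "M \<in> matchings G" and X: "X \<subseteq> verts G"
  shows "difference G X \<le> int (card (verts G)) - 2 * int (card M)"
proof -
  let ?N = "neighborhood G X"
  have edge: "\<exists>u v. e = {u, v} \<and> u \<rightarrow> v \<and> v \<rightarrow> u \<and> u \<noteq> v" if "e \<in> M" for e
  proof -
    have "e \<in> uedges G" using that M by (auto simp: matchings_def)
    then obtain u v where "e = {u, v}" "u \<rightarrow> v" by (auto simp: uedges_def)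
    then show ?thesis using adj_sym adj_not_same by blast
  qed
  have finX: "finite X" using X by (rule finite_subset_verts)
  have sub: "\<Union>M \<subseteq> verts G" using M by (auto simp: matchings_def uedges_def adj_in_verts)
  have "card (e \<inter> X) \<le> card (e \<inter> ?N)" if "e \<in> M" for e
  proof -
    obtain u v where e: "e = {u, v}" "u \<rightarrow> v" "v \<rightarrow> u" "u \<noteq> v" using edge[OF \<open>e \<in> M\<close>] by blast
    have "u \<in> ?N" if "v \<in> X" using that e adj_in_verts by (auto simp: neighborhood_def)
    moreover have "v \<in> ?N" if "u \<in> X" using that e adj_in_verts by (auto simp: neighborhood_def)
    ultimately show ?thesis using e by (cases "u \<in> X"; cases "v \<in> X") (auto simp: Int_insert_left)
  qed
  then have "(\<Sum>e\<in>M. card (e \<inter> X)) \<le> (\<Sum>e\<in>M. card (e \<inter> ?N))" by (rule sum_mono)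
  then have "card (\<Union>M \<inter> X) \<le> card (\<Union>M \<inter> ?N)"
    using M finX by (simp add: matching_card_Int)
  also have "\<dots> \<le> card ?N" by (simp add: card_mono)
  finally have 1: "card (\<Union>M \<inter> X) \<le> card ?N" .
  have "card (e \<inter> verts G) = 2" if "e \<in> M" for e
    using edge[OF that] adj_in_verts by (auto simp: Int_absorb2)
  then have "card (\<Union>M \<inter> verts G) = 2 * card M"
    using M by (simp add: matching_card_Int)
  then have 2: "card (\<Union>M) = 2 * card M" using sub by (simp add: Int_absorb2)
  have "card (X - \<Union>M) \<le> card (verts G - \<Union>M)" using X by (intro card_mono) auto
  also have "\<dots> = card (verts G) - card (\<Union>M)"
    using sub finite_subset_verts[OF sub] by (simp add: card_Diff_subset)
  finally have 3: "card (X - \<Union>M) \<le> card (verts G) - card (\<Union>M)" .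
  have "card (\<Union>M) \<le> card (verts G)" using sub by (simp add: card_mono)
  moreover have "card X = card (\<Union>M \<inter> X) + card (X - \<Union>M)"
    using finX card_Int_Diff[of X "\<Union>M"] by (simp add: Int_commute)
  ultimately show ?thesis using 1 2 3 by (simp add: difference_def)
qed

lemma independent_difference_ge:
  assumes "S \<in> independent_sets G"
  shows "2 * int (card S) - int (card (verts G)) \<le> difference G S"
proof -
  have S: "S \<subseteq> verts G" "S \<inter> neighborhood G S = {}" "finite S"
    using assms finite_independent by (auto simp: independent_sets_iff)
  then have "card S + card (neighborhood G S) = card (S \<union> neighborhood G S)"
    by (simp add: card_Un_disjoint)
  also have "\<dots> \<le> card (verts G)"
    using S neighborhood_subset by (intro card_mono) auto
  finally show ?thesis by (simp add: difference_def)
qed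

text \<open>For a maximum independent set S and a maximum matching, 2 \<alpha> - |V| \<le> d(S)
  \<le> |V| - 2 \<mu>.\<close>

lemma independence_plus_matching_le:
  "independence_number G + matching_number G \<le> card (verts G)"
proof -
  obtain S where S: "S \<in> independent_sets G" "card S = independence_number G"
    by (rule independence_number_eq)
  obtain M where M: "M \<in> matchings G" "card M = matching_number G"
    by (rule matching_number_eq)
  show ?thesis
    using independent_difference_ge[OF S(1)]
      difference_le_unmatched[OF M(1) independent_subset_verts[OF S(1)]] S M by linarith
qed

text \<open>A vertex outside A without neighbors in A could be added to A.\<close>

lemma maximum_neighborhood_eq:
  assumes "A \<in> independent_sets G" "card A = independence_number G"
  shows "neighborhood G A = verts G - A"
proof
  show "neighborhood G A \<subseteq> verts G - A"
    using assms(1) neighborhood_subset by (auto simp: independent_sets_iff)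
  show "verts G - A \<subseteq> neighborhood G A"
  proof (rule ccontr)
    assume "\<not> verts G - A \<subseteq> neighborhood G A"
    then obtain v where v: "v \<in> verts G" "v \<notin> A" "v \<notin> neighborhood G A" by blast
    then have "insert v A \<in> independent_sets G"
      using assms(1) adj_sym adj_not_same
      by (auto simp: independent_sets_def neighborhood_def)
    then have "card (insert v A) \<le> independence_number G" by (rule card_le_independence_number)
    then show False using assms v finite_independent by simp
  qed
qed

section \<open>Matching the neighborhood of a critical set into it\<close>

text \<open>Hall's condition comes from criticality: if K is the set of neighbors of J in A,
  removing K from A removes J from N(A), and d(A - K) \<le> d(A) yields |J| \<le> |K|.\<close>

lemma critical_neighborhood_matching:
  assumes "A \<in> critical_independent_sets G"
  obtains f where "inj_on f (neighborhood G A)"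
    "\<And>v. v \<in> neighborhood G A \<Longrightarrow> f v \<in> A \<and> v \<rightarrow> f v"
proof -
  note cA = critical_independent_setsD[OF assms]
  define S where "S v = {u \<in> A. v \<rightarrow> u}" for v
  have "card J \<le> card (\<Union>(S ` J))" if J: "J \<subseteq> neighborhood G A" for J
  proof -
    let ?K = "\<Union>(S ` J)"
    have K: "?K \<subseteq> A" by (auto simp: S_def)
    have "neighborhood G (A - ?K) \<subseteq> neighborhood G A - J"
      by (auto simp: neighborhood_def S_def)
    then have "card (neighborhood G (A - ?K)) \<le> card (neighborhood G A - J)"
      by (simp add: card_mono)
    also have "\<dots> = card (neighborhood G A) - card J"
      using J finite_subset[OF J] by (simp add: card_Diff_subset)
    finally have "card (neighborhood G (A - ?K)) \<le> card (neighborhood G A) - card J" .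
    moreover have "card J \<le> card (neighborhood G A)" using J by (simp add: card_mono)
    moreover have "card (A - ?K) = card A - card ?K" "card ?K \<le> card A"
      using K cA(3) finite_subset[OF K] by (auto simp: card_Diff_subset card_mono)
    moreover have "difference G (A - ?K) \<le> difference G A"
      unfolding cA(5) using cA(2) by (intro difference_le_max_difference) auto
    ultimately show ?thesis by (simp add: difference_def)
  qed
  then obtain f where "inj_on f (neighborhood G A)" "\<forall>v\<in>neighborhood G A. f v \<in> S v"
    using hall_marriage[of "neighborhood G A" S] cA(3) by (auto simp: S_def)
  then show thesis using that by (simp add: S_def)
qed

text \<open>The edges {v, f v} form a matching: f is injective, and its values lie in A, which is
  disjoint from N(A).\<close>

lemma card_neighborhood_critical_le_matching_number:
  assumes "A \<in> critical_independent_sets G"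
  shows "card (neighborhood G A) \<le> matching_number G"
proof -
  note cA = critical_independent_setsD[OF assms]
  let ?N = "neighborhood G A"
  obtain f where f: "inj_on f ?N" "\<And>v. v \<in> ?N \<Longrightarrow> f v \<in> A \<and> v \<rightarrow> f v"
    using critical_neighborhood_matching[OF assms] by blast
  have sep: "v \<noteq> f w" if "v \<in> ?N" "w \<in> ?N" for v w using that f(2)[of w] cA(4) by blast
  have dis: "{v, f v} \<inter> {w, f w} = {}" if "v \<in> ?N" "w \<in> ?N" "v \<noteq> w" for v w
    using sep[OF that(1,2)] sep[OF that(2,1)] that inj_onD[OF f(1), of v w] by auto
  let ?M = "(\<lambda>v. {v, f v}) ` ?N"
  have "inj_on (\<lambda>v. {v, f v}) ?N"
  proof (rule inj_onI)
    fix v w assume "v \<in> ?N" "w \<in> ?N" "{v, f v} = {w, f w}"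
    then show "v = w" using dis[of v w] by (cases "v = w") auto
  qed
  then have "card ?M = card ?N" by (rule card_image)
  moreover have "?M \<in> matchings G"
  proof -
    have "?M \<subseteq> uedges G" using f(2) by (auto simp: uedges_def)
    moreover have "pairwise disjnt ?M"
    proof (rule pairwiseI)
      fix e e' assume "e \<in> ?M" "e' \<in> ?M" "e \<noteq> e'"
      then obtain v w where "e = {v, f v}" "e' = {w, f w}" "v \<in> ?N" "w \<in> ?N" "v \<noteq> w"
        by blast
      then show "disjnt e e'" using dis[of v w] by (simp add: disjnt_def)
    qed
    ultimately show ?thesis by (simp add: matchings_def)
  qed
  then have "card ?M \<le> matching_number G" by (simp add: matching_number_def)
  ultimately show ?thesis by simp
qed

section \<open>The characterisation of Koenig-Egervary graphs\<close>

lemma koenig_egervary_iff_card_maximum_critical: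
  assumes A: "A \<in> maximum_critical_independent_sets G"
  shows "koenig_egervary_graph G \<longleftrightarrow> card A = independence_number G"
proof
  note crit = maximum_critical_independent_setsD(1)[OF A]
  note cA = critical_independent_setsD[OF crit]
  show "koenig_egervary_graph G" if "card A = independence_number G"
  proof -
    \<comment> \<open>This gives \<mu> \<ge> |V| - \<alpha>; the opposite inequality holds in every
      graph.\<close>
    have "card (neighborhood G A) = card (verts G) - card A"
      using maximum_neighborhood_eq[OF cA(1) that] cA by (simp add: card_Diff_subset)
    then show ?thesis
      using card_neighborhood_critical_le_matching_number[OF crit] that
        independence_plus_matching_le by (simp add: koenig_egervary_graph_def)
  qed
  show "card A = independence_number G" if KE: "koenig_egervary_graph G"
  proof -
    obtain S where S: "S \<in> independent_sets G" "card S = independence_number G"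
      by (rule independence_number_eq)
    obtain M where M: "M \<in> matchings G" "card M = matching_number G"
      by (rule matching_number_eq)
    \<comment> \<open>With \<alpha> + \<mu> = |V| the upper bound for d(A) and the lower bound for
      d(S) coincide, so S is critical too.\<close>
    have "max_difference = difference G A" using cA(5) by simp
    also have "\<dots> \<le> int (card (verts G)) - 2 * int (card M)"
      by (rule difference_le_unmatched[OF M(1) cA(2)])
    also have "\<dots> = 2 * int (card S) - int (card (verts G))"
      using KE S M unfolding koenig_egervary_graph_def by linarith
    also have "\<dots> \<le> difference G S" by (rule independent_difference_ge[OF S(1)])
    finally have "difference G S = max_difference"
      using difference_le_max_difference[OF independent_subset_verts[OF S(1)]] by simp
    then have "S \<in> critical_independent_sets G"
      using S by (simp add: critical_independent_sets_def)
    then show ?thesis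
      using maximum_critical_independent_setsD(2)[OF A] card_le_independence_number[OF cA(1)] S
      by fastforce
  qed
qed

text \<open>The defining equation becomes 2 |A| = 2 \<alpha> for any member A, a condition
  equivalent to one on the graph alone. Hence all such families qualify or none does.\<close>

lemma koenig_egervary_collection_maximum_critical_iff:
  assumes "\<Gamma> \<subseteq> maximum_critical_independent_sets G" "\<Gamma> \<noteq> {}"
  shows "koenig_egervary_collection G \<Gamma> \<longleftrightarrow> koenig_egervary_graph G"
proof -
  obtain A where A: "A \<in> \<Gamma>" using assms(2) by blast
  have "\<Gamma> \<subseteq> independent_sets G"
    using assms(1)
    by (auto intro: critical_independent_setsD(1) maximum_critical_independent_setsD(1))
  then show ?thesis
    using maximum_critical_card_Inter_Union[OF assms(1) A] assms(2)
      koenig_egervary_iff_card_maximum_critical[OF subsetD[OF assms(1) A]]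
    by (simp add: koenig_egervary_collection_def)
qed

end

theorem theorem2p5:
  fixes G :: "('a, 'b) pre_digraph"
  assumes "graph G"
  shows "(koenig_egervary_graph G \<longleftrightarrow>
            (\<forall>\<Gamma>. \<Gamma> \<noteq> {} \<and> \<Gamma> \<subseteq> maximum_critical_independent_sets G \<longrightarrow>
                  koenig_egervary_collection G \<Gamma>)) \<and>
         (koenig_egervary_graph G \<longleftrightarrow>
            (\<exists>\<Gamma>. \<Gamma> \<subseteq> maximum_critical_independent_sets G \<and>
                  koenig_egervary_collection G \<Gamma>))"
proof -
  interpret graph G by fact
  let ?F = "maximum_critical_independent_sets G"
  note iff = koenig_egervary_collection_maximum_critical_iff
  \<comment> \<open>The family of all maximum critical independent sets is non-empty; it keeps (ii)
    from being vacuous and serves as the witness in (iii).\<close>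
  note witness = iff[OF subset_refl maximum_critical_independent_sets_nonempty]
  have "koenig_egervary_graph G \<longleftrightarrow>
      (\<forall>\<Gamma>. \<Gamma> \<noteq> {} \<and> \<Gamma> \<subseteq> ?F \<longrightarrow> koenig_egervary_collection G \<Gamma>)"
    using iff witness maximum_critical_independent_sets_nonempty by (metis subset_refl)
  moreover have "koenig_egervary_graph G \<longleftrightarrow>
      (\<exists>\<Gamma>. \<Gamma> \<subseteq> ?F \<and> koenig_egervary_collection G \<Gamma>)"
    using iff witness by (metis koenig_egervary_collection_def subset_refl)
  ultimately show ?thesis ..
qed

end
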